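(* Let $H$ be a real Hilbert space, let $z\in H$ and let $C,D\subset H$ be closed convex subsets with $C\cap D\ne\emptyset$. Let $\beta\in(0,1)$ and let $\{r_k\}_{k\ge0}\subset(0,2(1-\beta)/\beta)$ satisfy $r_{k+1}=r_k/\sqrt{1+2r_k(1-\beta)/\beta}$ for all $k\ge0$. Let $z_0\in H$, $$x_0=\beta P_C\left(\frac{1}{\beta+r_0(1-\beta)}z_0+z\right)-\beta z,\qquad y_0=\frac1{r_0}(z_0-x_0),$$ and for $k=1,2,\dots$ $$x_k=\beta P_C\left(\frac{1}{\beta+r_{k-1}(1-\beta)}(z_{k-1}+r_{k-1}y_{k-1})+z\right)-\beta z,$$ $$y_k=\frac1{r_{k-1}}(z_{k-1}+r_{k-1}y_{k-1}-x_k),$$ $$z_k=\beta P_D\left(\frac{1}{\beta+r_k(1-\beta)}(x_k-r_ky_k)+z\right)-\beta z.$$ Let $r>0$ and $T:=(2J_{r(B_z)^{(\beta)}}-I)\circ(2J_{r(A_z)^{(\beta)}}-I)$ with $A:=N_C$ and $B:=N_D$. Then: (i) $J_{N_C+N_D}(z)$ exists if and only if there exists $x\in H$ such that $\{T^k(x)\}$ is bounded; (ii) if $J_{N_C+N_D}(z)$ exists, then $\{\frac1\beta x_k+z\}$ converges strongly (in norm) to $P_{C\cap D}(z)$, and $\Vert\frac1\beta x_{k+1}+z-P_{C\cap D}(z)\Vert=O(1/k)$ as $k\to\infty$.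
   Context: $I$ is the identity on $H$; $P_K$ is the metric projection onto a nonempty closed convex set $K$; $N_K$ is the normal cone operator, $N_K(x)=\{u\in H:\langle u,y-x\rangle\le0\ \forall y\in K\}$ if $x\in K$ and $N_K(x)=\emptyset$ otherwise (a maximal monotone operator). For a maximal monotone operator $M$ on $H$ and $\rho>0$, $J_{\rho M}=(I+\rho M)^{-1}$ (single-valued on all of $H$). "$J_{N_C+N_D}(z)$ exists" means that there is $u\in H$ with $z\in u+N_C(u)+N_D(u)$ (such $u$ is then unique and is denoted $J_{N_C+N_D}(z)$). For an operator $M\colon H\rightrightarrows H$, $(M_z)^{(\beta)}\colon H\rightrightarrows H$ is defined by $$(M_z)^{(\beta)}(x)=2(1-\beta)M\left(\frac1\beta x+z\right)+\frac{1-\beta}{\beta}x;$$ it is maximal monotone when $M$ is. *)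

theory Defs
  imports "HOL-Analysis.Analysis" "HOL-Library.Landau_Symbols" "HOL-Library.Set_Algebras"
begin

text \<open>
  A real Hilbert space is a type of sort \<open>{real_inner, complete_space}\<close>.  A set-valued operator
  \<open>H \<rightrightarrows> H\<close> is a function \<open>'a \<Rightarrow> 'a set\<close>, and sums of operator values are Minkowski sums.
\<close>

text \<open>
  The library's \<open>closest_point\<close> is restricted to \<open>heine_borel\<close>, i.e. to finite dimension.
  The description below is proper when \<open>K\<close> is nonempty, closed and convex and the space is complete.
\<close>

definition metric_proj :: "'a::real_inner set \<Rightarrow> 'a \<Rightarrow> 'a" where
  "metric_proj K x = (THE p. p \<in> K \<and> (\<forall>y\<in>K. dist x p \<le> dist x y))"

definition normal_cone :: "'a::real_inner set \<Rightarrow> 'a \<Rightarrow> 'a set" where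
  "normal_cone K x = (if x \<in> K then {u. \<forall>y\<in>K. inner u (y - x) \<le> 0} else {})"

definition op_add :: "('a::real_inner \<Rightarrow> 'a set) \<Rightarrow> ('a \<Rightarrow> 'a set) \<Rightarrow> 'a \<Rightarrow> 'a set" where
  "op_add M N x = M x + N x"

definition op_scale :: "real \<Rightarrow> ('a::real_inner \<Rightarrow> 'a set) \<Rightarrow> 'a \<Rightarrow> 'a set" where
  "op_scale c M x = (\<lambda>u. c *\<^sub>R u) ` M x"

definition resolvent_exists :: "('a::real_inner \<Rightarrow> 'a set) \<Rightarrow> 'a \<Rightarrow> bool" where
  "resolvent_exists M x \<longleftrightarrow> (\<exists>u. x \<in> {u} + M u)"

text \<open>
  \<open>(I + M)\<inverse>\<close> at \<open>x\<close>; for monotone \<open>M\<close> there is at most one such \<open>u\<close>, and for maximal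
  monotone \<open>M\<close> exactly one.
\<close>

definition resolvent :: "('a::real_inner \<Rightarrow> 'a set) \<Rightarrow> 'a \<Rightarrow> 'a" where
  "resolvent M x = (THE u. x \<in> {u} + M u)"

text \<open>Usually written \<open>(M_z)^(\<beta>)\<close>; it is maximal monotone whenever \<open>M\<close> is and \<open>0 < \<beta> < 1\<close>.\<close>

definition shifted_op :: "real \<Rightarrow> 'a::real_inner \<Rightarrow> ('a \<Rightarrow> 'a set) \<Rightarrow> 'a \<Rightarrow> 'a set" where
  "shifted_op \<beta> z M x =
     (\<lambda>u. (2 * (1 - \<beta>)) *\<^sub>R u) ` M ((1 / \<beta>) *\<^sub>R x + z) + {((1 - \<beta>) / \<beta>) *\<^sub>R x}"

definition reflected_resolvent :: "('a::real_inner \<Rightarrow> 'a set) \<Rightarrow> 'a \<Rightarrow> 'a" where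
  "reflected_resolvent M x = 2 *\<^sub>R resolvent M x - x"

end

theory Submission
  imports Defs
begin

text \<open>
  Write \<open>\<gamma> = (1 - \<beta>) / \<beta>\<close>, and let \<open>M\<close> and \<open>N\<close> be the shifted operators of the normal cones of \<open>C\<close> and
  \<open>D\<close>.  A normal cone absorbs positive factors, so \<open>M\<close> is the normal cone operator of the set
  \<open>\<beta> (C - z)\<close> plus \<open>\<gamma>\<close> times the identity, and likewise for \<open>N\<close>.  Three things follow.  Both
  operators are strongly monotone with modulus \<open>\<gamma>\<close>.  Their resolvents are the projection formulas that
  define the iteration.  The zeros of \<open>M + N\<close> are the points \<open>\<beta> (u - z)\<close> with \<open>z\<close> in
  \<open>u + N_C u + N_D u\<close>, and such a \<open>u\<close> is the projection of \<open>z\<close> onto \<open>C \<inter> D\<close>, because the sum of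
  the two normal cones lies in the normal cone of the intersection.

  For the equivalence, \<open>T\<close> has a fixed point iff \<open>M + N\<close> has a zero
  (\<open>reflected_resolvents_fixed_point_iff\<close>).  A fixed point is a bounded orbit.  Conversely, \<open>T\<close> is
  nonexpansive, and in a Hilbert space the asymptotic centre of a bounded orbit of a nonexpansive map is a
  fixed point (\<open>nonexpansive_bounded_orbit_fixed_point\<close>).

  For the rate, let \<open>x\<close> be a zero of \<open>M + N\<close>, with \<open>y\<close> in \<open>M x\<close> and \<open>- y\<close> in \<open>N x\<close>.  One step of
  the iteration turns \<open>\<parallel>x_k - x\<parallel>\<^sup>2 + r_k\<^sup>2 \<parallel>y_k - y\<parallel>\<^sup>2\<close> into a quantity that is not larger even after the
  factor \<open>1 + 2 r_k \<gamma>\<close> has been put in front of \<open>\<parallel>x_(k+1) - x\<parallel>\<^sup>2\<close> (\<open>primal_dual_step\<close>).  The rule for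
  the step sizes says exactly that this factor is \<open>r_k\<^sup>2 / r_(k+1)\<^sup>2\<close>, so
  \<open>\<parallel>x_k - x\<parallel>\<^sup>2 / r_k\<^sup>2 + \<parallel>y_k - y\<parallel>\<^sup>2\<close> does not increase and \<open>\<parallel>x_k - x\<parallel>\<close> is bounded by a multiple of
  \<open>r_k\<close>.  The same rule makes \<open>r_k\<close> decay like \<open>1 / k\<close> (\<open>accelerated_step_size_decay\<close>).
\<close>

section \<open>Minimising uniformly convex functions\<close>

lemma midpoint_norm_square:
  fixes a b :: "'a::real_inner"
  shows "(norm ((1/2) *\<^sub>R (a + b)))\<^sup>2 = ((norm a)\<^sup>2 + (norm b)\<^sup>2) / 2 - (norm (a - b))\<^sup>2 / 4"
proof -
  have "(norm (a + b))\<^sup>2 + (norm (a - b))\<^sup>2 = 2 * (norm a)\<^sup>2 + 2 * (norm b)\<^sup>2"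
    by (simp add: power2_norm_eq_inner algebra_simps)
  then show ?thesis
    by (simp add: power_divide) argo
qed

text \<open>
  The midpoint inequality bounds the squared distance of two points by their excess over the infimum, so
  minimising sequences are Cauchy.  This replaces compactness in infinite dimension, and serves both for
  projections (\<open>f\<close> a squared distance) and for asymptotic centres (\<open>f\<close> a limit superior of squared
  distances).
\<close>

lemma uniformly_convex_minimizer_ex1:
  fixes f :: "'a::{real_inner, complete_space} \<Rightarrow> real"
  assumes K: "closed K" "convex K" "K \<noteq> {}"
    and cont: "continuous_on K f"
    and nonneg: "\<And>x. x \<in> K \<Longrightarrow> 0 \<le> f x"
    and mid: "\<And>x y. x \<in> K \<Longrightarrow> y \<in> K \<Longrightarrow>
      f ((1/2) *\<^sub>R (x + y)) \<le> (f x + f y) / 2 - (norm (x - y))\<^sup>2 / 4"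
  shows "\<exists>!p. p \<in> K \<and> (\<forall>y\<in>K. f p \<le> f y)"
proof -
  define m where "m = Inf (f ` K)"
  have bdd: "bdd_below (f ` K)"
    using nonneg by (auto intro: bdd_belowI[of _ 0])
  have m_le: "m \<le> f x" if "x \<in> K" for x
    unfolding m_def using bdd that by (simp add: cINF_lower)
  have midK: "(1/2) *\<^sub>R (x + y) \<in> K" if "x \<in> K" "y \<in> K" for x y
    using convexD[OF K(2) that, of "1/2" "1/2"] by (simp add: scaleR_add_right)
  have close: "(norm (x - y))\<^sup>2 \<le> 2 * ((f x - m) + (f y - m))" if "x \<in> K" "y \<in> K" for x y
    using mid[OF that] m_le[OF midK[OF that]] by argo
  have "\<exists>x\<in>K. f x < m + 1 / real (Suc n)" for n
    using cInf_lessD[of "f ` K" "m + 1 / real (Suc n)"] K(3) by (auto simp: m_def)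
  then obtain s where sK: "\<And>n. s n \<in> K" and s: "\<And>n. f (s n) < m + 1 / real (Suc n)"
    by metis
  have flim: "(\<lambda>n. f (s n)) \<longlonglongrightarrow> m"
  proof (rule tendsto_sandwich[OF _ _ tendsto_const])
    show "(\<lambda>n. m + 1 / real (Suc n)) \<longlonglongrightarrow> m"
      using LIMSEQ_inverse_real_of_nat_add[of m] by (simp only: inverse_eq_divide)
    show "\<forall>\<^sub>F n in sequentially. m \<le> f (s n)"
      using m_le sK by simp
    show "\<forall>\<^sub>F n in sequentially. f (s n) \<le> m + 1 / real (Suc n)"
      using s by (intro always_eventually allI less_imp_le)
  qed
  have "Cauchy s"
  proof (rule metric_CauchyI)
    fix e :: real assume e: "0 < e"
    have "\<forall>\<^sub>F n in sequentially. f (s n) < m + e\<^sup>2 / 4"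
      using flim e by (intro order_tendstoD(2)) auto
    then obtain N where N: "\<And>n. n \<ge> N \<Longrightarrow> f (s n) < m + e\<^sup>2 / 4"
      by (auto simp: eventually_sequentially)
    have "dist (s i) (s j) < e" if "i \<ge> N" "j \<ge> N" for i j
    proof -
      have "(norm (s i - s j))\<^sup>2 < e\<^sup>2"
        using close[OF sK sK, of i j] N[OF that(1)] N[OF that(2)] by argo
      then show ?thesis
        using e by (simp add: dist_norm power2_less_imp_less)
    qed
    then show "\<exists>M. \<forall>i\<ge>M. \<forall>j\<ge>M. dist (s i) (s j) < e" by blast
  qed
  then obtain p where p: "s \<longlonglongrightarrow> p"
    using Cauchy_convergent_iff convergent_def by blast
  have pK: "p \<in> K"
    using closed_sequentially[OF K(1)] sK p by blast
  have "(\<lambda>n. f (s n)) \<longlonglongrightarrow> f p"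
    using continuous_on_tendsto_compose[OF cont p pK] sK by auto
  then have fp: "f p = m"
    using flim LIMSEQ_unique by blast
  show ?thesis
  proof (rule ex1I[of _ p])
    show "p \<in> K \<and> (\<forall>y\<in>K. f p \<le> f y)"
      using pK fp m_le by auto
    fix q assume q: "q \<in> K \<and> (\<forall>y\<in>K. f q \<le> f y)"
    then have "f q = m"
      using fp m_le pK by force
    then show "q = p"
      using close[of q p] q pK fp by simp
  qed
qed

section \<open>Metric projections and normal cones\<close>

lemma metric_proj_unique_exists:
  fixes K :: "'a::{real_inner, complete_space} set"
  assumes "closed K" "convex K" "K \<noteq> {}"
  shows "\<exists>!p. p \<in> K \<and> (\<forall>y\<in>K. dist x p \<le> dist x y)"
proof -
  have "\<exists>!p. p \<in> K \<and> (\<forall>y\<in>K. (norm (x - p))\<^sup>2 \<le> (norm (x - y))\<^sup>2)"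
  proof (rule uniformly_convex_minimizer_ex1[OF assms])
    show "continuous_on K (\<lambda>p. (norm (x - p))\<^sup>2)"
      by (intro continuous_intros)
    fix p q
    have "x - (1/2) *\<^sub>R (p + q) = (1/2) *\<^sub>R ((x - p) + (x - q))"
      by (simp add: algebra_simps flip: scaleR_add_left)
    then show "(norm (x - (1/2) *\<^sub>R (p + q)))\<^sup>2
        \<le> ((norm (x - p))\<^sup>2 + (norm (x - q))\<^sup>2) / 2 - (norm (p - q))\<^sup>2 / 4"
      using midpoint_norm_square[of "x - p" "x - q"] by (simp add: norm_minus_commute)
  qed auto
  then show ?thesis
    by (simp add: dist_norm)
qed

lemma normal_cone_imp_nearest:
  assumes "x - p \<in> normal_cone K p" and "y \<in> K"
  shows "dist x p \<le> dist x y"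
proof -
  have "inner (x - p) (y - p) \<le> 0"
    using assms by (auto simp: normal_cone_def split: if_splits)
  moreover have "(norm (x - y))\<^sup>2 = (norm (x - p))\<^sup>2 - 2 * inner (x - p) (y - p) + (norm (y - p))\<^sup>2"
    by (simp add: power2_norm_eq_inner algebra_simps inner_commute)
  ultimately have "(norm (x - p))\<^sup>2 \<le> (norm (x - y))\<^sup>2"
    using zero_le_power2[of "norm (y - p)"] by argo
  then show ?thesis
    by (simp add: dist_norm)
qed

lemma nearest_imp_normal_cone:
  fixes K :: "'a::real_inner set"
  assumes "convex K" "p \<in> K" and near: "\<And>y. y \<in> K \<Longrightarrow> dist x p \<le> dist x y"
  shows "x - p \<in> normal_cone K p"
proof -
  have "inner (x - p) (y - p) \<le> 0" if y: "y \<in> K" for y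
  proof (rule ccontr)
    assume "\<not> inner (x - p) (y - p) \<le> 0"
    then obtain u where u: "u > 0" "u \<le> 1" "dist x (p + u *\<^sub>R (y - p)) < dist x p"
      using closer_point_lemma[of x p y] by (auto simp: dist_commute)
    have "p + u *\<^sub>R (y - p) = (1 - u) *\<^sub>R p + u *\<^sub>R y"
      by (simp add: algebra_simps)
    also have "\<dots> \<in> K"
      using assms y u by (auto intro: convexD)
    finally show False
      using near u(3) by fastforce
  qed
  then show ?thesis
    using assms by (simp add: normal_cone_def)
qed

text \<open>
  The variational characterisation of the projection: the residual is a normal vector.  All later reasoning
  about projections goes through it.
\<close>

lemma metric_proj_eq_iff:
  fixes K :: "'a::{real_inner, complete_space} set"
  assumes "closed K" "convex K" "K \<noteq> {}"
  shows "metric_proj K x = p \<longleftrightarrow> x - p \<in> normal_cone K p"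
proof -
  note ex1 = metric_proj_unique_exists[OF assms, of x]
  have "metric_proj K x = p \<longleftrightarrow> p \<in> K \<and> (\<forall>y\<in>K. dist x p \<le> dist x y)"
    unfolding metric_proj_def using theI'[OF ex1] the1_equality[OF ex1] by blast
  also have "\<dots> \<longleftrightarrow> x - p \<in> normal_cone K p"
  proof
    assume "x - p \<in> normal_cone K p"
    then show "p \<in> K \<and> (\<forall>y\<in>K. dist x p \<le> dist x y)"
      using normal_cone_imp_nearest by (metis (lifting) empty_iff normal_cone_def)
  qed (use nearest_imp_normal_cone[OF assms(2)] in blast)
  finally show ?thesis .
qed

lemma normal_cone_scaleR:
  assumes "c > 0"
  shows "c *\<^sub>R u \<in> normal_cone K x \<longleftrightarrow> u \<in> normal_cone K x"
  using assms by (auto simp: normal_cone_def mult_le_0_iff)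

lemma normal_cone_add_Int:
  assumes "u \<in> normal_cone C x" "v \<in> normal_cone D x"
  shows "u + v \<in> normal_cone (C \<inter> D) x"
  using assms by (auto simp: normal_cone_def inner_add_left split: if_splits intro!: add_nonpos_nonpos)

lemma normal_cone_monotone:
  assumes "u \<in> normal_cone K x" "v \<in> normal_cone K y"
  shows "0 \<le> inner (u - v) (x - y)"
proof -
  have "inner u (y - x) \<le> 0" "inner v (x - y) \<le> 0"
    using assms by (auto simp: normal_cone_def split: if_splits)
  then show ?thesis
    by (simp add: algebra_simps)
qed

section \<open>The shifted normal cone operators\<close>

lemma resolvent_equation_iff: "w \<in> {u} + M u \<longleftrightarrow> w - u \<in> M u"
  for w u :: "'a::real_inner"
  by (auto simp: set_plus_def intro!: bexI[of _ "w - u"])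

text \<open>
  Since a normal cone is invariant under positive scaling, the factor \<open>2 (1 - \<beta>)\<close> disappears.
\<close>

lemma shifted_normal_cone_iff:
  assumes "0 < \<beta>" "\<beta> < 1"
  shows "y \<in> shifted_op \<beta> z (normal_cone K) x \<longleftrightarrow>
    y - ((1 - \<beta>) / \<beta>) *\<^sub>R x \<in> normal_cone K ((1 / \<beta>) *\<^sub>R x + z)"
    (is "_ \<longleftrightarrow> ?d \<in> ?N")
proof -
  have pos: "2 * (1 - \<beta>) > 0"
    using assms by simp
  have "?d \<in> ?N" if "y \<in> shifted_op \<beta> z (normal_cone K) x"
    using that by (auto simp: shifted_op_def set_plus_def normal_cone_scaleR[OF pos] simp del: right_diff_distrib_numeral)
  moreover have "y \<in> shifted_op \<beta> z (normal_cone K) x" if "?d \<in> ?N"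
  proof -
    have "?d = (2 * (1 - \<beta>)) *\<^sub>R ((1 / (2 * (1 - \<beta>))) *\<^sub>R ?d)"
      using pos by simp
    moreover have "(1 / (2 * (1 - \<beta>))) *\<^sub>R ?d \<in> ?N"
      using that pos by (subst normal_cone_scaleR) auto
    ultimately have "?d \<in> (\<lambda>u. (2 * (1 - \<beta>)) *\<^sub>R u) ` ?N"
      by blast
    then show ?thesis
      unfolding shifted_op_def using set_plus_intro[OF _ singletonI] by (metis diff_add_cancel)
  qed
  ultimately show ?thesis by blast
qed

lemma shifted_normal_cone_strongly_monotone:
  assumes "0 < \<beta>" "\<beta> < 1"
    and "y \<in> shifted_op \<beta> z (normal_cone K) x" "y' \<in> shifted_op \<beta> z (normal_cone K) x'"
  shows "(1 - \<beta>) / \<beta> * (norm (x - x'))\<^sup>2 \<le> inner (y - y') (x - x')"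
proof -
  let ?g = "(1 - \<beta>) / \<beta>"
  have "0 \<le> inner ((y - ?g *\<^sub>R x) - (y' - ?g *\<^sub>R x')) (((1 / \<beta>) *\<^sub>R x + z) - ((1 / \<beta>) *\<^sub>R x' + z))"
    using assms by (intro normal_cone_monotone[of _ K]) (simp_all add: shifted_normal_cone_iff)
  also have "\<dots> = (1 / \<beta>) * (inner (y - y') (x - x') - ?g * (norm (x - x'))\<^sup>2)"
  proof -
    have "((1 / \<beta>) *\<^sub>R x + z) - ((1 / \<beta>) *\<^sub>R x' + z) = (1 / \<beta>) *\<^sub>R (x - x')"
      by (simp add: scaleR_diff_right)
    moreover have "(y - ?g *\<^sub>R x) - (y' - ?g *\<^sub>R x') = (y - y') - ?g *\<^sub>R (x - x')"
      by (simp add: scaleR_diff_right)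
    ultimately show ?thesis
      by (simp only: inner_scaleR_right inner_scaleR_left inner_diff_left[of "y - y'"] power2_norm_eq_inner)
  qed
  finally show ?thesis
    using assms(1) by (simp add: zero_le_mult_iff zero_le_divide_iff)
qed

text \<open>
  The left-hand side is the resolvent equation of step \<open>s\<close>.  Multiplied by \<open>s / (\<beta> + s (1 - \<beta>))\<close>, it
  says that a residual at \<open>x / \<beta> + z\<close> is normal to \<open>K\<close>, because the coefficients of \<open>x\<close> add up to
  \<open>1 / \<beta>\<close>.
\<close>

lemma resolvent_formula_iff:
  fixes K :: "'a::{real_inner, complete_space} set"
  assumes "0 < \<beta>" "\<beta> < 1" "closed K" "convex K" "K \<noteq> {}" "0 < s"
  shows "(1 / s) *\<^sub>R (w - x) \<in> shifted_op \<beta> z (normal_cone K) x \<longleftrightarrow>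
    x = \<beta> *\<^sub>R metric_proj K ((1 / (\<beta> + s * (1 - \<beta>))) *\<^sub>R w + z) - \<beta> *\<^sub>R z"
proof -
  let ?p = "(1 / \<beta>) *\<^sub>R x + z" and ?b = "\<beta> + s * (1 - \<beta>)"
  have b: "?b > 0"
    using assms by (simp add: add_pos_pos)
  have c: "s / ?b > 0" using b assms by simp
  have "(s / ?b) *\<^sub>R ((1 / s) *\<^sub>R (w - x) - ((1 - \<beta>) / \<beta>) *\<^sub>R x)
      = (1 / ?b) *\<^sub>R w - (1 / ?b + (s / ?b) * ((1 - \<beta>) / \<beta>)) *\<^sub>R x"
    using assms(6) by (simp add: algebra_simps)
  also have "1 / ?b + (s / ?b) * ((1 - \<beta>) / \<beta>) = 1 / \<beta>"
  proof -
    have "?b / (?b * \<beta>) = \<beta> / (?b * \<beta>) + s * (1 - \<beta>) / (?b * \<beta>)"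
      by (rule add_divide_distrib)
    then show ?thesis using b assms(1) by simp
  qed
  also have "(1 / ?b) *\<^sub>R w - (1 / \<beta>) *\<^sub>R x = ((1 / ?b) *\<^sub>R w + z) - ?p"
    by simp
  finally have eq: "(s / ?b) *\<^sub>R ((1 / s) *\<^sub>R (w - x) - ((1 - \<beta>) / \<beta>) *\<^sub>R x)
      = ((1 / ?b) *\<^sub>R w + z) - ?p" .
  have "(1 / s) *\<^sub>R (w - x) \<in> shifted_op \<beta> z (normal_cone K) x \<longleftrightarrow>
      ((1 / ?b) *\<^sub>R w + z) - ?p \<in> normal_cone K ?p"
    unfolding shifted_normal_cone_iff[OF assms(1,2)] eq[symmetric] normal_cone_scaleR[OF c] ..
  also have "\<dots> \<longleftrightarrow> metric_proj K ((1 / ?b) *\<^sub>R w + z) = ?p"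
    by (simp add: metric_proj_eq_iff[OF assms(3-5)])
  also have "\<dots> \<longleftrightarrow> x = \<beta> *\<^sub>R metric_proj K ((1 / ?b) *\<^sub>R w + z) - \<beta> *\<^sub>R z"
  proof -
    have "x = \<beta> *\<^sub>R ?p - \<beta> *\<^sub>R z" using assms(1) by (simp add: algebra_simps)
    moreover have "q = ?p" if "x = \<beta> *\<^sub>R q - \<beta> *\<^sub>R z" for q
      using that assms(1) by (simp add: scaleR_diff_right)
    ultimately show ?thesis by metis
  qed
  finally show ?thesis .
qed

text \<open>
  The substitution is \<open>x = \<beta> (u - z)\<close>.  The identity term of each shifted operator is then
  \<open>(1 - \<beta>) (u - z)\<close>, and the two together supply the term \<open>u - z\<close> of the inclusion, up to the common
  factor \<open>2 (1 - \<beta>)\<close>.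
\<close>

lemma resolvent_exists_iff_zero:
  fixes z :: "'a::real_inner"
  assumes "0 < \<beta>" "\<beta> < 1"
  shows "resolvent_exists (op_add (normal_cone C) (normal_cone D)) z \<longleftrightarrow>
    (\<exists>x. \<exists>y\<in>shifted_op \<beta> z (normal_cone C) x. - y \<in> shifted_op \<beta> z (normal_cone D) x)"
proof
  assume "resolvent_exists (op_add (normal_cone C) (normal_cone D)) z"
  then obtain u m n where mn: "m \<in> normal_cone C u" "n \<in> normal_cone D u" "z = u + (m + n)"
    by (auto simp: resolvent_exists_def op_add_def set_plus_def)
  define x where "x = \<beta> *\<^sub>R (u - z)"
  define y where "y = (2 * (1 - \<beta>)) *\<^sub>R m + ((1 - \<beta>) / \<beta>) *\<^sub>R x"
  have pos: "2 * (1 - \<beta>) > 0" using assms by simp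
  have u: "(1 / \<beta>) *\<^sub>R x + z = u"
    using assms by (simp add: x_def)
  have "((1 - \<beta>) / \<beta>) *\<^sub>R x = (1 - \<beta>) *\<^sub>R (u - z)"
    using assms by (simp add: x_def)
  also have "\<dots> = (1 - \<beta>) *\<^sub>R (- m - n)"
    using mn(3) by simp
  finally have gx: "((1 - \<beta>) / \<beta>) *\<^sub>R x = (1 - \<beta>) *\<^sub>R (- m - n)" .
  have two: "(2 * (1 - \<beta>)) *\<^sub>R v = (1 - \<beta>) *\<^sub>R v + (1 - \<beta>) *\<^sub>R v" for v :: 'a
    by (simp flip: scaleR_add_left)
  have "- y - ((1 - \<beta>) / \<beta>) *\<^sub>R x = (2 * (1 - \<beta>)) *\<^sub>R n"
    unfolding y_def gx two by (simp add: scaleR_diff_right)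
  then have "- y \<in> shifted_op \<beta> z (normal_cone D) x"
    by (simp only: shifted_normal_cone_iff[OF assms] u normal_cone_scaleR[OF pos] mn(2))
  moreover have "y \<in> shifted_op \<beta> z (normal_cone C) x"
    by (simp only: shifted_normal_cone_iff[OF assms] u y_def add_diff_cancel_right' normal_cone_scaleR[OF pos] mn(1))
  ultimately show "\<exists>x. \<exists>y\<in>shifted_op \<beta> z (normal_cone C) x. - y \<in> shifted_op \<beta> z (normal_cone D) x"
    by blast
next
  assume "\<exists>x. \<exists>y\<in>shifted_op \<beta> z (normal_cone C) x. - y \<in> shifted_op \<beta> z (normal_cone D) x"
  then obtain x y where y: "y \<in> shifted_op \<beta> z (normal_cone C) x" "- y \<in> shifted_op \<beta> z (normal_cone D) x"
    by blast
  have pos: "1 / (2 * (1 - \<beta>)) > 0" using assms by simp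
  let ?u = "(1 / \<beta>) *\<^sub>R x + z" and ?g = "((1 - \<beta>) / \<beta>) *\<^sub>R x" and ?c = "1 / (2 * (1 - \<beta>))"
  have "?c *\<^sub>R (y - ?g) \<in> normal_cone C ?u" "?c *\<^sub>R (- y - ?g) \<in> normal_cone D ?u"
    using y by (simp_all only: shifted_normal_cone_iff[OF assms] normal_cone_scaleR[OF pos])
  then have "?u + (?c *\<^sub>R (y - ?g) + ?c *\<^sub>R (- y - ?g)) \<in> {?u} + (normal_cone C ?u + normal_cone D ?u)"
    by (intro set_plus_intro) auto
  moreover have "?c *\<^sub>R (y - ?g) + ?c *\<^sub>R (- y - ?g) = - ((1 / \<beta>) *\<^sub>R x)"
  proof -
    have "?c *\<^sub>R (y - ?g) + ?c *\<^sub>R (- y - ?g) = - ((2 * ?c * ((1 - \<beta>) / \<beta>)) *\<^sub>R x)"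
      by (simp add: scaleR_diff_right scaleR_minus_right flip: scaleR_2)
    also have "2 * ?c * ((1 - \<beta>) / \<beta>) = 1 / \<beta>"
      using assms by (simp add: field_simps)
    finally show ?thesis .
  qed
  ultimately show "resolvent_exists (op_add (normal_cone C) (normal_cone D)) z"
    by (auto simp: resolvent_exists_def op_add_def)
qed

lemma zero_imp_metric_proj_Int:
  fixes C D :: "'a::{real_inner, complete_space} set"
  assumes \<beta>: "0 < \<beta>" "\<beta> < 1"
    and CD: "closed C" "convex C" "closed D" "convex D" "C \<inter> D \<noteq> {}"
    and y: "y \<in> shifted_op \<beta> z (normal_cone C) x" "- y \<in> shifted_op \<beta> z (normal_cone D) x"
  shows "(1 / \<beta>) *\<^sub>R x + z = metric_proj (C \<inter> D) z"
proof -
  let ?p = "(1 / \<beta>) *\<^sub>R x + z" and ?g = "((1 - \<beta>) / \<beta>) *\<^sub>R x"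
  have "(y - ?g) + (- y - ?g) \<in> normal_cone (C \<inter> D) ?p"
    using y by (intro normal_cone_add_Int) (simp_all only: shifted_normal_cone_iff[OF \<beta>])
  also have "(y - ?g) + (- y - ?g) = (2 * (1 - \<beta>)) *\<^sub>R (z - ?p)"
    by (simp add: scaleR_minus_right flip: scaleR_2)
  finally have "z - ?p \<in> normal_cone (C \<inter> D) ?p"
    using \<beta> by (subst (asm) normal_cone_scaleR) auto
  then show ?thesis
    using metric_proj_eq_iff[of "C \<inter> D" z ?p] CD by (simp add: convex_Int closed_Int)
qed

section \<open>Bounded orbits of nonexpansive maps\<close>

text \<open>
  For a bounded sequence this is the limit superior of the distances to \<open>y\<close>.  The infimum of eventual upper
  bounds stays in the conditionally complete order of the reals.
\<close>

definition asymptotic_radius :: "(nat \<Rightarrow> 'a::metric_space) \<Rightarrow> 'a \<Rightarrow> real" where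
  "asymptotic_radius s y = Inf {c. \<forall>\<^sub>F k in sequentially. dist (s k) y \<le> c}"

lemma asymptotic_radius_le:
  assumes "\<forall>\<^sub>F k in sequentially. dist (s k) y \<le> c"
  shows "asymptotic_radius s y \<le> c"
  unfolding asymptotic_radius_def
proof (rule cInf_lower)
  show "bdd_below {c. \<forall>\<^sub>F k in sequentially. dist (s k) y \<le> c}"
  proof (rule bdd_belowI[of _ 0])
    fix c assume "c \<in> {c. \<forall>\<^sub>F k in sequentially. dist (s k) y \<le> c}"
    then obtain k where "dist (s k) y \<le> c"
      by (auto simp: eventually_sequentially)
    then show "0 \<le> c"
      using zero_le_dist order_trans by blast
  qed
qed (use assms in simp)

lemma
  assumes "bounded (range s)"
  shows asymptotic_radius_nonneg: "0 \<le> asymptotic_radius s y"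
    and eventually_asymptotic_radius:
      "asymptotic_radius s y < c \<Longrightarrow> \<forall>\<^sub>F k in sequentially. dist (s k) y \<le> c"
proof -
  obtain e where "\<And>k. dist y (s k) \<le> e"
    using assms by (auto simp: bounded_any_center[of _ y])
  then have ne: "{c. \<forall>\<^sub>F k in sequentially. dist (s k) y \<le> c} \<noteq> {}"
    by (auto simp: dist_commute intro!: exI[of _ e])
  show "0 \<le> asymptotic_radius s y"
    unfolding asymptotic_radius_def
  proof (rule cInf_greatest[OF ne])
    fix c assume "c \<in> {c. \<forall>\<^sub>F k in sequentially. dist (s k) y \<le> c}"
    then obtain k where "dist (s k) y \<le> c"
      by (auto simp: eventually_sequentially)
    then show "0 \<le> c"
      using zero_le_dist order_trans by blast
  qed
  assume "asymptotic_radius s y < c"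
  then obtain d where "d < c" "\<forall>\<^sub>F k in sequentially. dist (s k) y \<le> d"
    using cInf_lessD[OF ne] by (auto simp: asymptotic_radius_def)
  then show "\<forall>\<^sub>F k in sequentially. dist (s k) y \<le> c"
    by (auto elim: eventually_mono)
qed

lemma asymptotic_radius_lipschitz:
  assumes "bounded (range s)"
  shows "asymptotic_radius s x \<le> asymptotic_radius s y + dist x y"
proof (rule field_le_epsilon)
  fix e :: real assume "0 < e"
  then have "\<forall>\<^sub>F k in sequentially. dist (s k) y \<le> asymptotic_radius s y + e"
    by (intro eventually_asymptotic_radius[OF assms]) simp
  then show "asymptotic_radius s x \<le> asymptotic_radius s y + dist x y + e"
  proof (intro asymptotic_radius_le, elim eventually_mono)
    fix k assume "dist (s k) y \<le> asymptotic_radius s y + e"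
    then show "dist (s k) x \<le> asymptotic_radius s y + dist x y + e"
      using dist_triangle2[of "s k" x y] by linarith
  qed
qed

lemma continuous_asymptotic_radius:
  assumes "bounded (range s)"
  shows "continuous_on UNIV (asymptotic_radius s)"
  unfolding continuous_on_iff
proof (intro ballI allI impI)
  fix x and e :: real assume "0 < e"
  have "dist (asymptotic_radius s y) (asymptotic_radius s x) < e" if "dist y x < e" for y
    using that asymptotic_radius_lipschitz[OF assms, of x y]
      asymptotic_radius_lipschitz[OF assms, of y x]
    by (simp add: dist_real_def dist_commute)
  then show "\<exists>d>0. \<forall>y\<in>UNIV. dist y x < d \<longrightarrow> dist (asymptotic_radius s y) (asymptotic_radius s x) < e"
    using \<open>0 < e\<close> by blast
qed

text \<open>
  The parallelogram law holds along the sequence for every index, hence also for the limit superior.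
\<close>

lemma asymptotic_radius_midpoint:
  fixes s :: "nat \<Rightarrow> 'a::real_inner"
  assumes "bounded (range s)"
  shows "(asymptotic_radius s ((1/2) *\<^sub>R (x + y)))\<^sup>2
    \<le> ((asymptotic_radius s x)\<^sup>2 + (asymptotic_radius s y)\<^sup>2) / 2 - (norm (x - y))\<^sup>2 / 4"
proof -
  let ?R = "asymptotic_radius s" and ?m = "(1/2) *\<^sub>R (x + y)"
  have bound: "(?R ?m)\<^sup>2 \<le> ((?R x + e)\<^sup>2 + (?R y + e)\<^sup>2) / 2 - (norm (x - y))\<^sup>2 / 4"
    (is "_ \<le> ?b") if e: "0 < e" for e
  proof -
    have "\<forall>\<^sub>F k in sequentially. dist (s k) x \<le> ?R x + e \<and> dist (s k) y \<le> ?R y + e"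
      using e by (intro eventually_conj eventually_asymptotic_radius[OF assms]) auto
    then have ev: "\<forall>\<^sub>F k in sequentially. (dist (s k) ?m)\<^sup>2 \<le> ?b"
    proof eventually_elim
      case (elim k)
      have "s k - ?m = (1/2) *\<^sub>R ((s k - x) + (s k - y))"
        by (simp add: algebra_simps flip: scaleR_add_left)
      then have "(dist (s k) ?m)\<^sup>2 = ((dist (s k) x)\<^sup>2 + (dist (s k) y)\<^sup>2) / 2 - (norm (x - y))\<^sup>2 / 4"
        using midpoint_norm_square[of "s k - x" "s k - y"] by (simp add: norm_minus_commute dist_norm)
      moreover have "(dist (s k) x)\<^sup>2 \<le> (?R x + e)\<^sup>2" "(dist (s k) y)\<^sup>2 \<le> (?R y + e)\<^sup>2"
        using elim by (auto intro: power_mono)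
      ultimately show ?case by argo
    qed
    then obtain k where "(dist (s k) ?m)\<^sup>2 \<le> ?b"
      by (auto simp: eventually_sequentially)
    then have b: "0 \<le> ?b"
      using zero_le_power2 order_trans by blast
    have "?R ?m \<le> sqrt ?b"
      using ev by (intro asymptotic_radius_le) (auto elim!: eventually_mono intro: real_le_rsqrt)
    then show ?thesis
      using b asymptotic_radius_nonneg[OF assms, of ?m] power_mono[of "?R ?m" "sqrt ?b" 2] by simp
  qed
  have "((\<lambda>e. ((?R x + e)\<^sup>2 + (?R y + e)\<^sup>2) / 2 - (norm (x - y))\<^sup>2 / 4)
      \<longlongrightarrow> ((?R x + 0)\<^sup>2 + (?R y + 0)\<^sup>2) / 2 - (norm (x - y))\<^sup>2 / 4) (at_right 0)"
    by (intro tendsto_intros) simp_all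
  moreover have "\<forall>\<^sub>F e in at_right (0::real). (?R ?m)\<^sup>2 \<le>
      ((?R x + e)\<^sup>2 + (?R y + e)\<^sup>2) / 2 - (norm (x - y))\<^sup>2 / 4"
    using bound by (auto simp: eventually_at_right_less intro: eventually_at_rightI[of 0 1])
  ultimately show ?thesis
    using tendsto_lowerbound[of _ _ "at_right (0::real)" "(?R ?m)\<^sup>2"] by simp
qed

text \<open>
  Applying \<open>T\<close> shifts the orbit by one and does not increase distances, so \<open>T p\<close> has an asymptotic radius
  at most that of \<open>p\<close>.  If \<open>p\<close> is the unique minimiser, the asymptotic centre, then \<open>T p = p\<close>.
\<close>

lemma nonexpansive_bounded_orbit_fixed_point:
  fixes T :: "'a::{real_inner, complete_space} \<Rightarrow> 'a"
  assumes T: "\<And>x y. dist (T x) (T y) \<le> dist x y"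
    and bdd: "bounded (range (\<lambda>k. (T ^^ k) x))"
  shows "\<exists>p. T p = p"
proof -
  let ?s = "\<lambda>k. (T ^^ k) x"
  let ?R = "asymptotic_radius ?s"
  have "\<exists>!p. p \<in> UNIV \<and> (\<forall>y\<in>UNIV. (?R p)\<^sup>2 \<le> (?R y)\<^sup>2)"
    using asymptotic_radius_midpoint[OF bdd]
    by (intro uniformly_convex_minimizer_ex1 continuous_on_power continuous_asymptotic_radius[OF bdd]) auto
  then obtain p where p: "\<And>y. (?R p)\<^sup>2 \<le> (?R y)\<^sup>2"
    and uniq: "\<And>q. (\<And>y. (?R q)\<^sup>2 \<le> (?R y)\<^sup>2) \<Longrightarrow> q = p"
    unfolding Ex1_def by blast
  have "?R (T p) \<le> ?R p"
  proof (rule field_le_epsilon)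
    fix e :: real assume "0 < e"
    then have "\<forall>\<^sub>F k in sequentially. dist (?s k) p \<le> ?R p + e"
      by (intro eventually_asymptotic_radius[OF bdd]) simp
    then have "\<forall>\<^sub>F k in sequentially. dist (?s (Suc k)) (T p) \<le> ?R p + e"
      by eventually_elim (use T order_trans in fastforce)
    then have "\<forall>\<^sub>F k in sequentially. dist (?s k) (T p) \<le> ?R p + e"
      by (rule eventually_sequentially_Suc[THEN iffD1])
    then show "?R (T p) \<le> ?R p + e"
      by (rule asymptotic_radius_le)
  qed
  then have "(?R (T p))\<^sup>2 \<le> (?R p)\<^sup>2"
    using asymptotic_radius_nonneg[OF bdd] by (rule power_mono)
  then show ?thesis
    using p uniq order_trans by blast
qed

section \<open>The Peaceman--Rachford operator\<close>

lemma firmly_nonexpansive_reflection: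
  fixes u u' w w' :: "'a::real_inner"
  assumes "0 \<le> inner ((w - u) - (w' - u')) (u - u')"
  shows "dist (2 *\<^sub>R u - w) (2 *\<^sub>R u' - w') \<le> dist w w'"
proof -
  have "(norm ((2 *\<^sub>R u - w) - (2 *\<^sub>R u' - w')))\<^sup>2 =
      (norm (w - w'))\<^sup>2 - 4 * inner ((w - u) - (w' - u')) (u - u')"
    by (simp add: power2_norm_eq_inner algebra_simps inner_commute)
  then have "(norm ((2 *\<^sub>R u - w) - (2 *\<^sub>R u' - w')))\<^sup>2 \<le> (norm (w - w'))\<^sup>2"
    using assms by linarith
  then show ?thesis
    by (simp add: dist_norm)
qed

lemma reflected_resolvent_nonexpansive:
  fixes M :: "'a::real_inner \<Rightarrow> 'a set"
  assumes mono: "\<And>x x' y y'. y \<in> M x \<Longrightarrow> y' \<in> M x' \<Longrightarrow> 0 \<le> inner (y - y') (x - x')"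
    and res: "\<And>w. w - resolvent M w \<in> M (resolvent M w)"
  shows "dist (reflected_resolvent M w) (reflected_resolvent M w') \<le> dist w w'"
  unfolding reflected_resolvent_def
  by (intro firmly_nonexpansive_reflection mono res)

text \<open>
  With \<open>u\<close> the first resolvent of \<open>x\<close>, the point \<open>x\<close> is fixed iff \<open>u\<close> is also the second resolvent of
  the reflected point \<open>2 u - x\<close>.  The two residuals are then \<open>x - u\<close> and \<open>- (x - u)\<close>; conversely, a zero
  \<open>u\<close> with selection \<open>y\<close> gives the fixed point \<open>u + y\<close>.
\<close>

lemma reflected_resolvents_fixed_point_iff:
  fixes M N :: "'a::real_inner \<Rightarrow> 'a set"
  assumes M: "\<And>w u. resolvent M w = u \<longleftrightarrow> w - u \<in> M u"
    and N: "\<And>w u. resolvent N w = u \<longleftrightarrow> w - u \<in> N u"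
  shows "(\<exists>x. reflected_resolvent N (reflected_resolvent M x) = x) \<longleftrightarrow>
    (\<exists>u. \<exists>y\<in>M u. - y \<in> N u)"
proof
  assume "\<exists>x. reflected_resolvent N (reflected_resolvent M x) = x"
  then obtain x where x: "reflected_resolvent N (reflected_resolvent M x) = x" by blast
  define u where "u = resolvent M x"
  have "2 *\<^sub>R resolvent N (2 *\<^sub>R u - x) = 2 *\<^sub>R u"
    using x unfolding reflected_resolvent_def u_def[symmetric] by (simp add: algebra_simps)
  then have "resolvent N (2 *\<^sub>R u - x) = u" by simp
  then have "(2 *\<^sub>R u - x) - u \<in> N u"
    using N by simp
  moreover have "(2 *\<^sub>R u - x) - u = - (x - u)"
    by (simp add: scaleR_2)
  moreover have "x - u \<in> M u"
    using M u_def by blast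
  ultimately show "\<exists>u. \<exists>y\<in>M u. - y \<in> N u" by metis
next
  assume "\<exists>u. \<exists>y\<in>M u. - y \<in> N u"
  then obtain u y where y: "y \<in> M u" "- y \<in> N u" by blast
  have "resolvent M (u + y) = u" "resolvent N (u - y) = u"
    using y by (simp_all add: M N)
  moreover have "2 *\<^sub>R u - (u + y) = u - y"
    by (simp add: scaleR_2)
  ultimately have "reflected_resolvent N (reflected_resolvent M (u + y)) = u + y"
    by (simp add: reflected_resolvent_def scaleR_2)
  then show "\<exists>x. reflected_resolvent N (reflected_resolvent M x) = x" by blast
qed

lemma mem_op_scale_iff:
  assumes "0 < s"
  shows "y \<in> op_scale s M x \<longleftrightarrow> (1 / s) *\<^sub>R y \<in> M x"
proof
  assume "(1 / s) *\<^sub>R y \<in> M x"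
  then show "y \<in> op_scale s M x"
    unfolding op_scale_def by (rule rev_image_eqI) (use assms in simp)
qed (use assms in \<open>auto simp: op_scale_def\<close>)

lemma resolvent_shifted_normal_cone_iff:
  fixes K :: "'a::{real_inner, complete_space} set"
  assumes "0 < \<beta>" "\<beta> < 1" "closed K" "convex K" "K \<noteq> {}" "0 < s"
  shows "resolvent (op_scale s (shifted_op \<beta> z (normal_cone K))) w = u \<longleftrightarrow>
    w - u \<in> op_scale s (shifted_op \<beta> z (normal_cone K)) u"
  unfolding resolvent_def resolvent_equation_iff mem_op_scale_iff[OF assms(6)]
    resolvent_formula_iff[OF assms]
  by auto

section \<open>Convergence rate of the accelerated iteration\<close>

text \<open>
  All quantities are differences to a solution: \<open>a\<close> and \<open>b\<close> for the current iterates \<open>x_k\<close> and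
  \<open>y_k\<close>, \<open>a'\<close> and \<open>b'\<close> for the next ones, \<open>c\<close> for \<open>z_k\<close>, and \<open>v\<close> for the selection of the second
  operator at \<open>z_k\<close>.  The two resolvent equations make the difference of the energies
  \<open>\<parallel>a\<parallel>\<^sup>2 + r\<^sup>2 \<parallel>b\<parallel>\<^sup>2\<close> and \<open>\<parallel>a'\<parallel>\<^sup>2 + r\<^sup>2 \<parallel>b'\<parallel>\<^sup>2\<close> a square plus \<open>2 r\<close> times the two inner
  products that monotonicity controls.
\<close>

lemma primal_dual_step:
  fixes a b a' b' v c :: "'a::real_inner"
  assumes B: "c + r *\<^sub>R v = a - r *\<^sub>R b"
    and A: "a' + r *\<^sub>R b' = c + r *\<^sub>R b"
    and r: "0 < r"
    and monoA: "g * (norm a')\<^sup>2 \<le> inner b' a'"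
    and monoB: "0 \<le> inner v c"
  shows "(1 + 2 * r * g) * (norm a')\<^sup>2 + r\<^sup>2 * (norm b')\<^sup>2 \<le> (norm a)\<^sup>2 + r\<^sup>2 * (norm b)\<^sup>2"
proof -
  define s q t where "s = r *\<^sub>R b'" and "q = r *\<^sub>R v" and "t = r *\<^sub>R b"
  have t: "t = a' + s - c"
    using A by (simp add: s_def t_def)
  have a: "a = a' + s + q"
    using A B by (simp add: s_def t_def q_def algebra_simps)
  have "(norm a)\<^sup>2 + (norm t)\<^sup>2 =
      (norm a')\<^sup>2 + (norm s)\<^sup>2 + (norm (a' + s + q - c))\<^sup>2 + 2 * inner s a' + 2 * inner q c"
    unfolding a t by (simp add: power2_norm_eq_inner algebra_simps inner_commute)
  moreover have "r * (g * (norm a')\<^sup>2) \<le> inner s a'"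
    unfolding s_def using monoA r by simp
  moreover have "inner q c \<ge> 0"
    unfolding q_def using monoB r by simp
  moreover have "(norm t)\<^sup>2 = r\<^sup>2 * (norm b)\<^sup>2" "(norm s)\<^sup>2 = r\<^sup>2 * (norm b')\<^sup>2"
    by (simp_all add: t_def s_def power_mult_distrib)
  moreover have "(1 + 2 * r * g) * (norm a')\<^sup>2 = (norm a')\<^sup>2 + 2 * (r * (g * (norm a')\<^sup>2))"
    by (simp add: algebra_simps)
  ultimately show ?thesis
    using zero_le_power2[of "norm (a' + s + q - c)"] by linarith
qed

text \<open>
  In terms of \<open>t = 1 / r\<close> the recursion is \<open>t_(k+1)\<^sup>2 = t_k\<^sup>2 + 2 g t_k\<close>, whose increments tend to \<open>g\<close>; it
  is enough that they stay above a positive constant.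
\<close>

lemma accelerated_step_size_decay:
  fixes r :: "nat \<Rightarrow> real"
  assumes r: "\<And>k. 0 < r k" and g: "0 < g"
    and rec: "\<And>k. r (Suc k) = r k / sqrt (1 + 2 * r k * g)"
  shows "\<exists>c>0. \<forall>k. c * real k * r k \<le> 1"
proof -
  define t where "t k = 1 / r k" for k
  \<comment> \<open>An increment of \<open>c\<close> is safe as soon as \<open>c (2 t k + c) \<le> 2 g t k\<close>, and \<open>c \<le> t k\<close> bounds the
      left-hand side by \<open>3 c t k\<close>.\<close>
  define c where "c = min (t 0) (2 * g / 3)"
  have t: "t k > 0" for k
    using r by (simp add: t_def)
  have c: "0 < c" "c \<le> t 0" "c \<le> 2 * g / 3"
    using t g by (auto simp: c_def)
  have tsq: "(t (Suc k))\<^sup>2 = (t k)\<^sup>2 + 2 * g * t k" for k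
  proof -
    have "1 + 2 * r k * g > 0" using r g by (simp add: add_pos_pos)
    then have "(t (Suc k))\<^sup>2 = (1 + 2 * r k * g) / (r k)\<^sup>2"
      by (simp add: t_def rec power_divide)
    also have "\<dots> = (t k)\<^sup>2 + 2 * g * t k"
      using r[of k] by (simp add: t_def field_simps power2_eq_square)
    finally show ?thesis .
  qed
  have lower: "t k \<ge> t 0 + c * real k" for k
  proof (induction k)
    case (Suc k)
    have ct: "c \<le> t k"
      using Suc c by (smt (verit) mult_nonneg_nonneg of_nat_0_le_iff)
    have "(t k + c)\<^sup>2 = (t k)\<^sup>2 + c * (2 * t k + c)"
      by (simp add: power2_eq_square algebra_simps)
    also have "c * (2 * t k + c) \<le> (2 * g / 3) * (3 * t k)"
      using ct c t[of k] by (intro mult_mono) auto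
    finally have "(t k + c)\<^sup>2 \<le> (t (Suc k))\<^sup>2"
      by (simp add: tsq)
    then have "t k + c \<le> t (Suc k)"
      by (rule power2_le_imp_le) (use t[of "Suc k"] in simp)
    then show ?case
      using Suc by (simp add: algebra_simps)
  qed simp
  have "c * real k * r k \<le> 1" for k
  proof -
    have "c * real k \<le> 1 / r k"
      using lower[of k] t[of 0] unfolding t_def by linarith
    then show ?thesis
      using r[of k] by (simp add: pos_le_divide_eq)
  qed
  then show ?thesis
    using c by blast
qed

text \<open>
  The starting point \<open>zs 0\<close> is arbitrary and need not come from a resolvent of \<open>N\<close>, so the energy \<open>E\<close> is
  known to decrease from index 1 on only and is compared with its value there.
\<close>

lemma accelerated_iteration_rate:
  fixes xs ys zs :: "nat \<Rightarrow> 'a::real_inner" and M N :: "'a \<Rightarrow> 'a set"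
  assumes r: "\<And>k. 0 < r k" and g: "0 < g"
    and rec: "\<And>k. r (Suc k) = r k / sqrt (1 + 2 * r k * g)"
    and monoM: "\<And>x x' y y'. y \<in> M x \<Longrightarrow> y' \<in> M x' \<Longrightarrow> g * (norm (x - x'))\<^sup>2 \<le> inner (y - y') (x - x')"
    and monoN: "\<And>x x' y y'. y \<in> N x \<Longrightarrow> y' \<in> N x' \<Longrightarrow> 0 \<le> inner (y - y') (x - x')"
    and M: "\<And>k. ys (Suc k) \<in> M (xs (Suc k))"
    and xs: "\<And>k. xs (Suc k) + r k *\<^sub>R ys (Suc k) = zs k + r k *\<^sub>R ys k"
    and N: "\<And>k. (1 / r (Suc k)) *\<^sub>R (xs (Suc k) - r (Suc k) *\<^sub>R ys (Suc k) - zs (Suc k)) \<in> N (zs (Suc k))"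
    and zero: "y \<in> M x" "- y \<in> N x"
  shows "\<exists>b. \<forall>k\<ge>1. norm (xs k - x) \<le> b / real k"
proof -
  define E where "E k = (norm (xs k - x))\<^sup>2 / (r k)\<^sup>2 + (norm (ys k - y))\<^sup>2" for k
  have E_step: "E (Suc k) \<le> E k" if "k \<ge> 1" for k
  proof -
    obtain j where k: "k = Suc j" using \<open>k \<ge> 1\<close> by (cases k) auto
    define v where "v = (1 / r k) *\<^sub>R (xs k - r k *\<^sub>R ys k - zs k) - (- y)"
    have "(1 + 2 * r k * g) * (norm (xs (Suc k) - x))\<^sup>2 + (r k)\<^sup>2 * (norm (ys (Suc k) - y))\<^sup>2
        \<le> (norm (xs k - x))\<^sup>2 + (r k)\<^sup>2 * (norm (ys k - y))\<^sup>2"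
    proof (rule primal_dual_step[where c = "zs k - x" and v = v])
      have "r k *\<^sub>R v = (xs k - r k *\<^sub>R ys k - zs k) + r k *\<^sub>R y"
        using r[of k] by (simp add: v_def scaleR_add_right)
      then show "(zs k - x) + r k *\<^sub>R v = (xs k - x) - r k *\<^sub>R (ys k - y)"
        by (simp add: algebra_simps)
      show "(xs (Suc k) - x) + r k *\<^sub>R (ys (Suc k) - y) = (zs k - x) + r k *\<^sub>R (ys k - y)"
        using xs[of k] by (simp add: algebra_simps)
      show "0 \<le> inner v (zs k - x)"
        unfolding v_def using N[of j] zero(2) by (intro monoN) (auto simp: k)
      show "g * (norm (xs (Suc k) - x))\<^sup>2 \<le> inner (ys (Suc k) - y) (xs (Suc k) - x)"
        using M zero(1) by (intro monoM)
    qed (use r g in \<open>auto simp: less_imp_le\<close>)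
    then have "((1 + 2 * r k * g) * (norm (xs (Suc k) - x))\<^sup>2 + (r k)\<^sup>2 * (norm (ys (Suc k) - y))\<^sup>2) / (r k)\<^sup>2
        \<le> ((norm (xs k - x))\<^sup>2 + (r k)\<^sup>2 * (norm (ys k - y))\<^sup>2) / (r k)\<^sup>2"
      by (rule divide_right_mono) simp
    also have "\<dots> = E k"
      using r[of k] by (simp add: E_def add_divide_distrib)
    also have "((1 + 2 * r k * g) * (norm (xs (Suc k) - x))\<^sup>2 + (r k)\<^sup>2 * (norm (ys (Suc k) - y))\<^sup>2) / (r k)\<^sup>2
        = E (Suc k)"
    proof -
      have "1 + 2 * r k * g > 0" using r g by (simp add: add_pos_pos)
      then have "(r (Suc k))\<^sup>2 = (r k)\<^sup>2 / (1 + 2 * r k * g)"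
        by (simp add: rec power_divide)
      then show ?thesis
        using r[of k] by (simp add: E_def add_divide_distrib mult.commute)
    qed
    finally show ?thesis .
  qed
  have E_le: "E k \<le> E 1" if "k \<ge> 1" for k
    using that by (induction k rule: dec_induct) (use E_step order_trans in auto)
  have norm_le: "norm (xs k - x) \<le> sqrt (E 1) * r k" if "k \<ge> 1" for k
  proof -
    have "(norm (xs k - x) / r k)\<^sup>2 \<le> E k"
      by (simp add: E_def power_divide)
    also have "\<dots> \<le> E 1" by (rule E_le[OF that])
    finally have "norm (xs k - x) / r k \<le> sqrt (E 1)"
      by (rule real_le_rsqrt)
    then show ?thesis
      using r[of k] by (simp add: pos_divide_le_eq)
  qed
  obtain c where c: "c > 0" "\<And>k. c * real k * r k \<le> 1"
    using accelerated_step_size_decay[where r = r and g = g] r g rec by blast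
  have "norm (xs k - x) \<le> (sqrt (E 1) / c) / real k" if "k \<ge> 1" for k
  proof -
    have "r k \<le> 1 / (c * real k)"
      using c(1) c(2)[of k] that by (simp add: pos_le_divide_eq mult.commute)
    moreover have "0 \<le> sqrt (E 1)"
      by (simp add: E_def)
    ultimately have "sqrt (E 1) * r k \<le> sqrt (E 1) * (1 / (c * real k))"
      by (rule mult_left_mono)
    then show ?thesis
      using norm_le[OF that] by simp
  qed
  then show ?thesis by blast
qed

theorem corollary5p3:
  fixes z :: "'a::{real_inner, complete_space}"
    and C D :: "'a set"
    and \<beta> \<rho> :: real
    and r :: "nat \<Rightarrow> real"
    and xs ys zs :: "nat \<Rightarrow> 'a"
    and A B :: "'a \<Rightarrow> 'a set"
    and T :: "'a \<Rightarrow> 'a"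
  assumes "closed C" and "convex C" and "closed D" and "convex D"
    and "C \<inter> D \<noteq> {}"
    and "0 < \<beta>" and "\<beta> < 1"
    and "\<forall>k. 0 < r k \<and> r k < 2 * (1 - \<beta>) / \<beta>"
    and "\<forall>k. r (Suc k) = r k / sqrt (1 + 2 * r k * (1 - \<beta>) / \<beta>)"
    and "xs 0 = \<beta> *\<^sub>R metric_proj C ((1 / (\<beta> + r 0 * (1 - \<beta>))) *\<^sub>R zs 0 + z) - \<beta> *\<^sub>R z"
    and "ys 0 = (1 / r 0) *\<^sub>R (zs 0 - xs 0)"
    and "\<forall>k\<ge>1. xs k =
           \<beta> *\<^sub>R metric_proj C ((1 / (\<beta> + r (k - 1) * (1 - \<beta>))) *\<^sub>R
                  (zs (k - 1) + r (k - 1) *\<^sub>R ys (k - 1)) + z) - \<beta> *\<^sub>R z"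
    and "\<forall>k\<ge>1. ys k =
           (1 / r (k - 1)) *\<^sub>R (zs (k - 1) + r (k - 1) *\<^sub>R ys (k - 1) - xs k)"
    and "\<forall>k\<ge>1. zs k =
           \<beta> *\<^sub>R metric_proj D ((1 / (\<beta> + r k * (1 - \<beta>))) *\<^sub>R
                  (xs k - r k *\<^sub>R ys k) + z) - \<beta> *\<^sub>R z"
    and "\<rho> > 0"
    and "A = normal_cone C" and "B = normal_cone D"
    and "T = reflected_resolvent (op_scale \<rho> (shifted_op \<beta> z B)) \<circ>
             reflected_resolvent (op_scale \<rho> (shifted_op \<beta> z A))"
  shows "(resolvent_exists (op_add (normal_cone C) (normal_cone D)) z \<longleftrightarrow>
            (\<exists>x. bounded (range (\<lambda>k. (T ^^ k) x)))) \<and>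
         (resolvent_exists (op_add (normal_cone C) (normal_cone D)) z \<longrightarrow>
            (\<lambda>k. (1 / \<beta>) *\<^sub>R xs k + z) \<longlonglongrightarrow> metric_proj (C \<inter> D) z \<and>
            (\<lambda>k. norm ((1 / \<beta>) *\<^sub>R xs (k + 1) + z - metric_proj (C \<inter> D) z))
              \<in> O(\<lambda>k. 1 / real k))"
proof -
  define M N where "M = shifted_op \<beta> z (normal_cone C)" and "N = shifted_op \<beta> z (normal_cone D)"
  let ?g = "(1 - \<beta>) / \<beta>"
  note CD = assms(1-5) and \<beta> = assms(6,7)
  have C: "closed C" "convex C" "C \<noteq> {}" and D: "closed D" "convex D" "D \<noteq> {}"
    using CD by auto
  have r: "0 < r k" for k
    using assms(8) by simp
  have g: "0 < ?g"
    using \<beta> by simp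
  have monoM: "?g * (norm (x - x'))\<^sup>2 \<le> inner (y - y') (x - x')" if "y \<in> M x" "y' \<in> M x'" for x x' y y'
    using that shifted_normal_cone_strongly_monotone[OF \<beta>] by (simp add: M_def)
  have monoN: "?g * (norm (x - x'))\<^sup>2 \<le> inner (y - y') (x - x')" if "y \<in> N x" "y' \<in> N x'" for x x' y y'
    using that shifted_normal_cone_strongly_monotone[OF \<beta>] by (simp add: N_def)
  \<comment> \<open>Positive scaling keeps an operator monotone; this is used for both factors of \<open>T\<close>.\<close>
  have mono_scale: "0 \<le> inner (y - y') (x - x')"
    if "\<And>x x' y y'. y \<in> L x \<Longrightarrow> y' \<in> L x' \<Longrightarrow> ?g * (norm (x - x'))\<^sup>2 \<le> inner (y - y') (x - x')"
      and "y \<in> op_scale s L x" "y' \<in> op_scale s L x'" "0 < s"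
    for L :: "'a \<Rightarrow> 'a set" and s x x' y y'
  proof -
    have "0 \<le> ?g * (norm (x - x'))\<^sup>2" using g by (intro mult_nonneg_nonneg) simp_all
    also have "\<dots> \<le> inner ((1 / s) *\<^sub>R y - (1 / s) *\<^sub>R y') (x - x')"
      using that by (intro that(1)) (simp_all add: mem_op_scale_iff)
    also have "\<dots> = (1 / s) * inner (y - y') (x - x')"
      by (simp flip: scaleR_diff_right)
    finally show ?thesis
      using that(4) by (simp add: zero_le_divide_iff)
  qed
  have resM: "resolvent (op_scale \<rho> M) w = u \<longleftrightarrow> w - u \<in> op_scale \<rho> M u" for w u
    unfolding M_def by (rule resolvent_shifted_normal_cone_iff[OF \<beta> C assms(15)])
  have resN: "resolvent (op_scale \<rho> N) w = u \<longleftrightarrow> w - u \<in> op_scale \<rho> N u" for w u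
    unfolding N_def by (rule resolvent_shifted_normal_cone_iff[OF \<beta> D assms(15)])
  have T: "T w = reflected_resolvent (op_scale \<rho> N) (reflected_resolvent (op_scale \<rho> M) w)" for w
    using assms(16-18) by (simp add: M_def N_def)
  have "dist (T w) (T w') \<le> dist w w'" for w w'
  proof -
    have "dist (T w) (T w') \<le>
        dist (reflected_resolvent (op_scale \<rho> M) w) (reflected_resolvent (op_scale \<rho> M) w')"
      unfolding T using resN assms(15)
      by (intro reflected_resolvent_nonexpansive) (auto intro: mono_scale[OF monoN])
    also have "\<dots> \<le> dist w w'"
      using resM assms(15)
      by (intro reflected_resolvent_nonexpansive) (auto intro: mono_scale[OF monoM])
    finally show ?thesis .
  qed
  then have "(\<exists>x. bounded (range (\<lambda>k. (T ^^ k) x))) \<Longrightarrow> \<exists>p. T p = p"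
    using nonexpansive_bounded_orbit_fixed_point by blast
  moreover have "\<exists>x. bounded (range (\<lambda>k. (T ^^ k) x))" if "T p = p" for p
  proof -
    have "(T ^^ k) p = p" for k
      using that by (induction k) auto
    then show ?thesis by (intro exI[of _ p]) simp
  qed
  ultimately have "(\<exists>x. bounded (range (\<lambda>k. (T ^^ k) x))) \<longleftrightarrow> (\<exists>p. T p = p)"
    by blast
  also have "\<dots> \<longleftrightarrow> (\<exists>u. \<exists>y\<in>op_scale \<rho> M u. - y \<in> op_scale \<rho> N u)"
    unfolding T by (rule reflected_resolvents_fixed_point_iff[OF resM resN])
  also have "\<dots> \<longleftrightarrow> (\<exists>u. \<exists>y\<in>M u. - y \<in> N u)"
  proof -
    have "(\<exists>y\<in>op_scale \<rho> M u. - y \<in> op_scale \<rho> N u) \<longleftrightarrow> (\<exists>y\<in>M u. - y \<in> N u)" for u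
      unfolding Bex_def mem_op_scale_iff[OF assms(15)]
    proof safe
      fix y assume "y \<in> M u" "- y \<in> N u"
      then show "\<exists>y. (1 / \<rho>) *\<^sub>R y \<in> M u \<and> (1 / \<rho>) *\<^sub>R - y \<in> N u"
        using assms(15) by (intro exI[of _ "\<rho> *\<^sub>R y"]) simp
    next
      fix y assume "(1 / \<rho>) *\<^sub>R y \<in> M u" "(1 / \<rho>) *\<^sub>R - y \<in> N u"
      then show "\<exists>y. y \<in> M u \<and> - y \<in> N u"
        by (metis scaleR_minus_right)
    qed
    then show ?thesis by simp
  qed
  also have "\<dots> \<longleftrightarrow> resolvent_exists (op_add (normal_cone C) (normal_cone D)) z"
    unfolding M_def N_def by (rule resolvent_exists_iff_zero[OF \<beta>, symmetric])
  finally have part1: "resolvent_exists (op_add (normal_cone C) (normal_cone D)) z \<longleftrightarrow>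
      (\<exists>x. bounded (range (\<lambda>k. (T ^^ k) x)))" ..
  have part2: "(\<lambda>k. (1 / \<beta>) *\<^sub>R xs k + z) \<longlonglongrightarrow> metric_proj (C \<inter> D) z \<and>
      (\<lambda>k. norm ((1 / \<beta>) *\<^sub>R xs (k + 1) + z - metric_proj (C \<inter> D) z)) \<in> O(\<lambda>k. 1 / real k)"
    if ex: "resolvent_exists (op_add (normal_cone C) (normal_cone D)) z"
  proof -
    obtain x y where zero: "y \<in> M x" "- y \<in> N x"
      using ex resolvent_exists_iff_zero[OF \<beta>] unfolding M_def N_def by blast
    have ys_eq: "ys (Suc k) = (1 / r k) *\<^sub>R (zs k + r k *\<^sub>R ys k - xs (Suc k))" for k
      using assms(13)[rule_format, of "Suc k"] by simp
    have "\<exists>b. \<forall>k\<ge>1. norm (xs k - x) \<le> b / real k"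
    proof (rule accelerated_iteration_rate[where r = r and g = ?g and M = M and N = N])
      show "y \<in> M x" "- y \<in> N x" by (fact zero)+
      fix k
      show "r (Suc k) = r k / sqrt (1 + 2 * r k * ?g)"
        using assms(9) by simp
      show "ys (Suc k) \<in> M (xs (Suc k))"
        unfolding ys_eq M_def resolvent_formula_iff[OF \<beta> C r]
        using assms(12)[rule_format, of "Suc k"] by simp
      show "xs (Suc k) + r k *\<^sub>R ys (Suc k) = zs k + r k *\<^sub>R ys k"
        unfolding ys_eq using r[of k] by simp
      show "(1 / r (Suc k)) *\<^sub>R (xs (Suc k) - r (Suc k) *\<^sub>R ys (Suc k) - zs (Suc k)) \<in> N (zs (Suc k))"
        unfolding N_def resolvent_formula_iff[OF \<beta> D r]
        using assms(14)[rule_format, of "Suc k"] by simp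
    next
      fix x x' y y' assume "y \<in> N x" "y' \<in> N x'"
      then show "0 \<le> inner (y - y') (x - x')"
        using monoN g by (meson less_imp_le mult_nonneg_nonneg order_trans zero_le_power2)
    qed (use r g monoM in blast)+
    then obtain b where b: "\<And>k. k \<ge> 1 \<Longrightarrow> norm (xs k - x) \<le> b / real k"
      by blast
    let ?P = "metric_proj (C \<inter> D) z"
    have P: "(1 / \<beta>) *\<^sub>R x + z = ?P"
      using zero unfolding M_def N_def by (rule zero_imp_metric_proj_Int[OF \<beta> CD])
    have err: "norm ((1 / \<beta>) *\<^sub>R xs k + z - ?P) \<le> (b / \<beta>) * (1 / real k)" if "k \<ge> 1" for k
    proof -
      have "(1 / \<beta>) *\<^sub>R xs k + z - ?P = (1 / \<beta>) *\<^sub>R (xs k - x)"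
        by (simp add: scaleR_diff_right flip: P)
      then have "norm ((1 / \<beta>) *\<^sub>R xs k + z - ?P) = (1 / \<beta>) * norm (xs k - x)"
        using \<beta> by simp
      also have "\<dots> \<le> (1 / \<beta>) * (b / real k)"
        using b[OF that] \<beta> by (intro mult_left_mono) auto
      finally show ?thesis by (simp add: mult.commute)
    qed
    have "(\<lambda>k. (1 / \<beta>) *\<^sub>R xs k + z - ?P) \<longlonglongrightarrow> 0"
    proof (rule Lim_null_comparison)
      show "\<forall>\<^sub>F k in sequentially. norm ((1 / \<beta>) *\<^sub>R xs k + z - ?P) \<le> (b / \<beta>) * (1 / real k)"
        using err by (auto simp: eventually_sequentially)
      show "(\<lambda>k. (b / \<beta>) * (1 / real k)) \<longlonglongrightarrow> 0"
        by (rule tendsto_mult_right_zero[OF lim_1_over_n])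
    qed
    then have lim: "(\<lambda>k. (1 / \<beta>) *\<^sub>R xs k + z) \<longlonglongrightarrow> ?P"
      by (simp add: LIM_zero_iff)
    have b0: "0 \<le> b"
      using order_trans[OF norm_ge_zero b[of 1]] by simp
    have "(\<lambda>k. norm ((1 / \<beta>) *\<^sub>R xs (k + 1) + z - ?P)) \<in> O(\<lambda>k. 1 / real k)"
    proof (rule bigoI)
      show "\<forall>\<^sub>F k in sequentially. norm (norm ((1 / \<beta>) *\<^sub>R xs (k + 1) + z - ?P))
          \<le> (b / \<beta>) * norm (1 / real k)"
        unfolding eventually_sequentially
      proof (intro exI[of _ 1] allI impI)
        fix k :: nat assume k: "1 \<le> k"
        have "norm ((1 / \<beta>) *\<^sub>R xs (k + 1) + z - ?P) \<le> (b / \<beta>) * (1 / real (k + 1))"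
          by (rule err) simp
        also have "\<dots> \<le> (b / \<beta>) * (1 / real k)"
          using k b0 \<beta> by (intro mult_left_mono divide_left_mono) auto
        finally show "norm (norm ((1 / \<beta>) *\<^sub>R xs (k + 1) + z - ?P)) \<le> (b / \<beta>) * norm (1 / real k)"
          by simp
      qed
    qed
    with lim show ?thesis by blast
  qed
  show ?thesis
    using part1 part2 by blast
qed

end
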